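(* For an integer $m\ge 2$ let $\mathcal{R}(-m)$ be the collection of doubly transitive strongly regular graphs whose adjacency matrix has smallest eigenvalue $-m$. Then the essential performance ratio $$e(\mathcal{R}(-m)):=\lim_{n\to\infty}\inf\{\alpha_G: G\in\mathcal{R}(-m),\ |G|\ge n\}$$ equals $1$.
   Context: Graphs are finite, simple, undirected, loopless; $|G|$ is the number of vertices and $M$ the $0/1$ adjacency matrix. A graph is strongly regular if it is regular, every two adjacent vertices have the same number of common neighbours, and every two distinct nonadjacent vertices have the same number of common neighbours. A graph is doubly transitive if for every vertex $v$ and all neighbours $i,j$ of $v$ there is an automorphism fixing $v$ and sending $i$ to $j$. For an assignment $f$ of $V$ to unit vectors in some $\mathbb{R}^{p+1}$, let $SD(f):=\sum_{i<j}M_{ij}\frac{1-f(i)\cdot f(j)}{2}$ and $SD(G):=\max_f SD(f)$. Let $\mathbb{E}[W(f)]:=\frac1\pi\sum_{i<j}M_{ij}\arccos(f(i)\cdot f(j))$; this is the expected weight of the cut $\{i: H(f(i))\ge0\}$ versus its complement for a uniformly random linear functional $H$ in the unit sphere. The performance ratio is $\alpha_G:=\mathbb{E}[W(f^* )]/SD(G)$, where $f^*$ is an optimal embedding ($SD(f^* )=SD(G)$) whose Gram matrix $(f^*(i)\cdot f^*(j))_{ij}$ is invariant under $\mathrm{Aut}(G)$. Such an embedding is obtained by averaging an optimal Gram matrix over $\mathrm{Aut}(G)$. *)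

theory Defs
  imports Complex_Main
    "HOL-Combinatorics.Permutations"
    "Graph_Theory.Pair_Digraph"
    "Jordan_Normal_Form.Char_Poly"
begin

(* A finite simple graph is a pair_graph (finite, symmetric, loopless, no parallel arcs): the edge
   ij is represented by the two arcs (i, j) and (j, i). As in the sums over i < j below, the
   vertices are numbered; every finite simple graph is isomorphic to one of this form. *)

definition numbered_graph :: "nat pair_pre_digraph \<Rightarrow> bool" where
  "numbered_graph G \<longleftrightarrow> pair_graph G \<and> pverts G = {0..<card (pverts G)}"

abbreviation order :: "nat pair_pre_digraph \<Rightarrow> nat" where
  "order G \<equiv> card (pverts G)"

definition adj_mat :: "nat pair_pre_digraph \<Rightarrow> real mat" where
  "adj_mat G = mat (order G) (order G) (\<lambda>(i, j). if (i, j) \<in> parcs G then 1 else 0)"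

definition smallest_eigenvalue :: "real mat \<Rightarrow> real \<Rightarrow> bool" where
  "smallest_eigenvalue A r \<longleftrightarrow> eigenvalue A r \<and> (\<forall>k. eigenvalue A k \<longrightarrow> r \<le> k)"

definition neighbours :: "nat pair_pre_digraph \<Rightarrow> nat \<Rightarrow> nat set" where
  "neighbours G v = {u \<in> pverts G. (v, u) \<in> parcs G}"

definition regular :: "nat pair_pre_digraph \<Rightarrow> bool" where
  "regular G \<longleftrightarrow> (\<exists>k. \<forall>v \<in> pverts G. card (neighbours G v) = k)"

definition strongly_regular :: "nat pair_pre_digraph \<Rightarrow> bool" where
  "strongly_regular G \<longleftrightarrow> regular G
     \<and> (\<exists>l. \<forall>u \<in> pverts G. \<forall>v \<in> pverts G.
            (u, v) \<in> parcs G \<longrightarrow> card (neighbours G u \<inter> neighbours G v) = l)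
     \<and> (\<exists>c. \<forall>u \<in> pverts G. \<forall>v \<in> pverts G.
            u \<noteq> v \<and> (u, v) \<notin> parcs G \<longrightarrow> card (neighbours G u \<inter> neighbours G v) = c)"

definition Aut :: "nat pair_pre_digraph \<Rightarrow> (nat \<Rightarrow> nat) set" where
  "Aut G = {\<phi>. \<phi> permutes pverts G
     \<and> (\<forall>u \<in> pverts G. \<forall>v \<in> pverts G. (\<phi> u, \<phi> v) \<in> parcs G \<longleftrightarrow> (u, v) \<in> parcs G)}"

definition doubly_transitive :: "nat pair_pre_digraph \<Rightarrow> bool" where
  "doubly_transitive G \<longleftrightarrow> (\<forall>v \<in> pverts G. \<forall>i \<in> neighbours G v. \<forall>j \<in> neighbours G v.
     \<exists>\<phi> \<in> Aut G. \<phi> v = v \<and> \<phi> i = j)"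

(* The dimension p + 1 is arbitrary, but the same for all vertices. *)

definition unit_embedding :: "nat pair_pre_digraph \<Rightarrow> (nat \<Rightarrow> real vec) \<Rightarrow> bool" where
  "unit_embedding G f \<longleftrightarrow>
     (\<exists>p. \<forall>i \<in> pverts G. f i \<in> carrier_vec (p + 1) \<and> f i \<bullet> f i = 1)"

definition SD_val :: "nat pair_pre_digraph \<Rightarrow> (nat \<Rightarrow> real vec) \<Rightarrow> real" where
  "SD_val G f = (\<Sum>(i, j) \<in> {(i, j). i < j \<and> j < order G}.
     adj_mat G $$ (i, j) * ((1 - f i \<bullet> f j) / 2))"

(* GREATEST is the maximum; it exists by compactness, since n dimensions suffice for n vertices. *)

definition SD :: "nat pair_pre_digraph \<Rightarrow> real" where
  "SD G = (GREATEST s. \<exists>f. unit_embedding G f \<and> s = SD_val G f)"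

definition expected_cut :: "nat pair_pre_digraph \<Rightarrow> (nat \<Rightarrow> real vec) \<Rightarrow> real" where
  "expected_cut G f = 1 / pi * (\<Sum>(i, j) \<in> {(i, j). i < j \<and> j < order G}.
     adj_mat G $$ (i, j) * arccos (f i \<bullet> f j))"

definition optimal_embedding :: "nat pair_pre_digraph \<Rightarrow> (nat \<Rightarrow> real vec) \<Rightarrow> bool" where
  "optimal_embedding G f \<longleftrightarrow> unit_embedding G f \<and> SD_val G f = SD G"

definition invariant_gram :: "nat pair_pre_digraph \<Rightarrow> (nat \<Rightarrow> real vec) \<Rightarrow> bool" where
  "invariant_gram G f \<longleftrightarrow>
     (\<forall>\<phi> \<in> Aut G. \<forall>i \<in> pverts G. \<forall>j \<in> pverts G. f (\<phi> i) \<bullet> f (\<phi> j) = f i \<bullet> f j)"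

(* An embedding as selected here always exists (average an optimal Gram matrix over Aut G). For a
   connected doubly transitive graph the ratio does not depend on the choice: Aut G is transitive
   on edges, so f i \<bullet> f j takes a single value on edges, and SD G determines it. *)

definition performance_ratio :: "nat pair_pre_digraph \<Rightarrow> real" where
  "performance_ratio G =
     expected_cut G (SOME f. optimal_embedding G f \<and> invariant_gram G f) / SD G"

definition \<R> :: "real \<Rightarrow> nat pair_pre_digraph set" where
  "\<R> r = {G. numbered_graph G \<and> doubly_transitive G \<and> strongly_regular G
            \<and> smallest_eigenvalue (adj_mat G) r}"

definition has_essential_performance_ratio :: "nat pair_pre_digraph set \<Rightarrow> real \<Rightarrow> bool" where
  "has_essential_performance_ratio K e \<longleftrightarrow>
     (\<lambda>n. Inf (performance_ratio ` {G \<in> K. order G \<ge> n})) \<longlonglongrightarrow> e"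

end

theory Submission
  imports Defs
begin

text \<open>
  Let $G$ be a doubly transitive strongly regular graph with $n$ vertices, degree $k$, adjacency
  matrix $A$ and smallest eigenvalue $-\mu$, where $\mu > 1$. Maximizing $SD$ means minimizing the sum
  of $f(i) \cdot f(j)$ over all arcs. This sum is at least $- \mu n$, because $A + \mu I$ is positive
  semidefinite (\<open>srg_matrix.quadratic_form_ge\<close>), and the bound is attained by the scaled columns of
  the projection to the eigenspace of $-\mu$, which all have the same length: the projection is a
  combination of $I$, $A$ and the all-ones matrix $J$, so its diagonal is constant
  (\<open>srg_matrix.embed_quadratic\<close>). Hence $SD(G) = n (k + \mu) / 4$.

  The graph is connected, and double transitivity makes its automorphism group transitive on edges up
  to direction (\<open>edge_values_equal\<close>). An optimal embedding with invariant Gram matrix therefore has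
  inner product $- \mu / k$ on every edge, and
  \[ \alpha_G = \frac{2 k \arccos(- \mu / k)}{\pi (k + \mu)} \]
  (\<open>performance_ratio_formula\<close>). For fixed $\mu$ this tends to 1 as $k \to \infty$. Finally
  $n \le k (k + \mu)$ (\<open>srg_matrix.order_le\<close>), so large graphs have large degree and the ratios
  converge to 1 uniformly. Complete multipartite graphs with parts of size $m$ show that the family
  contains arbitrarily large graphs, so that the infima are taken over nonempty sets.

  Positivity, the projection and the bound on $n$ all follow from the equation
  $(A + \mu I)(A - r I) = c J$, where $r$ is the third eigenvalue, $c \ge 1$ the number of common
  neighbours of distinct nonadjacent vertices. The locale \<open>srg_matrix\<close> contains
  these arguments, and \<open>strongly_regular_parameters\<close> derives the equation for a graph.
\<close>

section \<open>Sums over pairs of vertices\<close>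

lemma sum_of_bool_mult:
  fixes f :: "nat \<Rightarrow> real"
  assumes "i < n"
  shows "(\<Sum>j\<in>{0..<n}. of_bool (i = j) * f j) = f i" "(\<Sum>j\<in>{0..<n}. f j * of_bool (j = i)) = f i"
  using assms by (simp_all add: of_bool_def if_distrib[of "\<lambda>x. x * _"] if_distrib[of "\<lambda>x. _ * x"] sum.delta cong: if_cong)

lemma sum_upper_triangle:
  fixes g :: "nat \<Rightarrow> nat \<Rightarrow> real"
  assumes sym: "\<And>i j. i < n \<Longrightarrow> j < n \<Longrightarrow> g i j = g j i"
    and diag: "\<And>i. i < n \<Longrightarrow> g i i = 0"
  shows "(\<Sum>(i, j)\<in>{(i, j). i < j \<and> j < n}. g i j) = (\<Sum>i\<in>{0..<n}. \<Sum>j\<in>{0..<n}. g i j) / 2"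
proof -
  let ?U = "{(i, j). i < j \<and> j < n}" and ?L = "{(i, j). j < i \<and> i < n}"
  let ?D = "{(i, j). i = j \<and> i < n}"
  have sub: "?U \<subseteq> {0..<n} \<times> {0..<n}" "?L \<subseteq> {0..<n} \<times> {0..<n}" "?D \<subseteq> {0..<n} \<times> {0..<n}"
    by auto
  note fin = sub[THEN finite_subset, OF finite_cartesian_product[OF finite_atLeastLessThan finite_atLeastLessThan]]
  have split: "{0..<n} \<times> {0..<n} = (?U \<union> ?L) \<union> ?D"
    by auto
  have "(\<Sum>(i, j)\<in>?L. g i j) = (\<Sum>(i, j)\<in>?U. g i j)"
    by (rule sum.reindex_bij_witness[where i = prod.swap and j = prod.swap])
      (auto intro: sym)
  moreover have "(\<Sum>(i, j)\<in>?D. g i j) = 0"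
    by (rule sum.neutral) (auto simp: diag)
  moreover have "(\<Sum>i\<in>{0..<n}. \<Sum>j\<in>{0..<n}. g i j)
      = (\<Sum>(i, j)\<in>?U. g i j) + (\<Sum>(i, j)\<in>?L. g i j) + (\<Sum>(i, j)\<in>?D. g i j)"
    unfolding sum.cartesian_product split
    by (subst sum.union_disjoint, (use fin in auto)[3])+ simp
  ultimately show ?thesis
    by simp
qed

section \<open>The matrix algebra of a strongly regular graph\<close>

text \<open>
  The equation satisfied by the square of the adjacency matrix $A$ of a connected strongly regular
  graph of degree \<open>k\<close>, where \<open>c\<close> is the number of common neighbours of two distinct
  nonadjacent vertices.
  The coefficients are written in terms of the two eigenvalues \<open>r\<close> and \<open>- \<mu>\<close> other than
  \<open>k\<close>: the equation says $(A + \mu I)(A - r I) = c J$ with $J$ the all-ones matrix. In this form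
  the bounds below become polynomial identities in $A$, $I$ and $J$.
\<close>

locale srg_matrix =
  fixes n :: nat and a :: "nat \<Rightarrow> nat \<Rightarrow> real" and k c r \<mu> :: real
  assumes sym: "\<And>i j. i < n \<Longrightarrow> j < n \<Longrightarrow> a i j = a j i"
    and diag: "\<And>i. i < n \<Longrightarrow> a i i = 0"
    and row: "\<And>i. i < n \<Longrightarrow> (\<Sum>j\<in>{0..<n}. a i j) = k"
    and sq: "\<And>i j. i < n \<Longrightarrow> j < n \<Longrightarrow>
      (\<Sum>h\<in>{0..<n}. a i h * a h j) = \<mu> * r * of_bool (i = j) + (r - \<mu>) * a i j + c"
    and pos: "n > 0" "\<mu> > 0" "c \<ge> 1" "r \<ge> 0" "k \<ge> 0"
begin

lemma column_sum: "j < n \<Longrightarrow> (\<Sum>i\<in>{0..<n}. a i j) = k"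
  using row[of j] sym by (metis (mono_tags, lifting) atLeastLessThan_iff sum.cong)

text \<open>
  Both sides are the row sum of $(A + \mu I)(A - r I) = c J$.
\<close>

lemma order_identity: "(k + \<mu>) * (k - r) = c * n"
proof -
  have "(\<Sum>j\<in>{0..<n}. \<Sum>h\<in>{0..<n}. a 0 h * a h j) = k * k"
    by (subst sum.swap) (simp add: sum_distrib_left[symmetric] sum_distrib_right[symmetric] row pos)
  moreover have "(\<Sum>j\<in>{0..<n}. \<Sum>h\<in>{0..<n}. a 0 h * a h j)
      = (\<Sum>j\<in>{0..<n}. \<mu> * r * of_bool (0 = j) + (r - \<mu>) * a 0 j + c)"
    by (intro sum.cong) (auto simp: sq pos)
  moreover have "\<dots> = \<mu> * r + (r - \<mu>) * k + c * n"
    using sum_of_bool_mult(1)[of 0 n "\<lambda>_. \<mu> * r"]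
    by (simp add: sum.distrib sum_distrib_left[symmetric] row pos mult.commute)
  ultimately show ?thesis
    by (simp add: algebra_simps)
qed

lemma k_gt: "k > r"
proof -
  have "(k + \<mu>) * (k - r) > 0"
    unfolding order_identity using pos by simp
  then show ?thesis
    using pos by (simp add: zero_less_mult_iff)
qed

text \<open>
  For fixed \<open>\<mu>\<close> this forces the degree to infinity with the number of vertices. It follows from
  \<open>order_identity\<close> because \<open>c \<ge> 1\<close> and \<open>r \<ge> 0\<close>.
\<close>

lemma order_le: "n \<le> k * (k + \<mu>)"
proof -
  have "n \<le> c * n"
    using mult_right_mono[OF pos(3), of n] by simp
  also have "\<dots> = (k + \<mu>) * (k - r)"
    by (simp add: order_identity)
  also have "\<dots> \<le> (k + \<mu>) * k"
    using pos by (intro mult_left_mono) auto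
  finally show ?thesis
    by (simp add: mult.commute)
qed

text \<open>
  Positive semidefiniteness of $A + \mu I$. Since
  $(A + \mu I)^2 = (r + \mu)(A + \mu I) + c J$, the form of $A + \mu I$ at $x$ is a positive multiple
  of $\|(A + \mu I) x\|^2 - c X^2$ with $X = \sum_i x_i$. The coordinates of $(A + \mu I) x$ sum to
  $(k + \mu) X$, so Cauchy-Schwarz bounds its squared norm below by $(k + \mu)^2 X^2 / n$, and
  $(k + \mu)^2 \ge (k + \mu)(k - r) = c n$.
\<close>

lemma quadratic_form_ge:
  fixes x :: "nat \<Rightarrow> real"
  shows "(\<Sum>i\<in>{0..<n}. \<Sum>j\<in>{0..<n}. a i j * (x i * x j)) \<ge> - \<mu> * (\<Sum>i\<in>{0..<n}. (x i)\<^sup>2)"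
proof -
  define X where "X = (\<Sum>i\<in>{0..<n}. x i)"
  define N where "N = (\<Sum>i\<in>{0..<n}. (x i)\<^sup>2)"
  define Q where "Q = (\<Sum>i\<in>{0..<n}. \<Sum>j\<in>{0..<n}. a i j * (x i * x j))"
  define z where "z i = (\<Sum>j\<in>{0..<n}. a i j * x j)" for i
  define y where "y i = z i + \<mu> * x i" for i
  have xz: "(\<Sum>i\<in>{0..<n}. x i * z i) = Q"
    by (simp add: Q_def z_def sum_distrib_left ac_simps)
  have zz: "(\<Sum>i\<in>{0..<n}. (z i)\<^sup>2) = \<mu> * r * N + (r - \<mu>) * Q + c * X\<^sup>2"
  proof -
    have "(\<Sum>i\<in>{0..<n}. (z i)\<^sup>2)
        = (\<Sum>i\<in>{0..<n}. \<Sum>j\<in>{0..<n}. \<Sum>h\<in>{0..<n}. a i j * x j * (a i h * x h))"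
      by (simp add: z_def power2_eq_square sum_product)
    also have "\<dots> = (\<Sum>j\<in>{0..<n}. \<Sum>h\<in>{0..<n}. \<Sum>i\<in>{0..<n}. a i j * x j * (a i h * x h))"
      by (subst sum.swap, rule sum.cong[OF refl], rule sum.swap)
    also have "\<dots> = (\<Sum>j\<in>{0..<n}. \<Sum>h\<in>{0..<n}. (\<Sum>i\<in>{0..<n}. a j i * a i h) * (x j * x h))"
      by (intro sum.cong refl, unfold sum_distrib_right, rule sum.cong[OF refl]) (simp add: sym ac_simps)
    also have "\<dots> = (\<Sum>j\<in>{0..<n}. \<Sum>h\<in>{0..<n}. (\<mu> * r * x j) * (of_bool (j = h) * x h)
        + (r - \<mu>) * (a j h * (x j * x h)) + c * (x j * x h))"
      by (intro sum.cong refl) (simp add: sq algebra_simps)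
    also have "\<dots> = \<mu> * r * N + (r - \<mu>) * Q + c * X\<^sup>2"
      unfolding sum.distrib sum_distrib_left[symmetric]
      by (simp add: sum_of_bool_mult N_def Q_def X_def power2_eq_square sum_product sum_distrib_left
          ac_simps)
    finally show ?thesis .
  qed
  have Y: "(\<Sum>i\<in>{0..<n}. y i) = (k + \<mu>) * X"
  proof -
    have "(\<Sum>i\<in>{0..<n}. z i) = (\<Sum>j\<in>{0..<n}. (\<Sum>i\<in>{0..<n}. a i j) * x j)"
      unfolding z_def sum_distrib_right by (rule sum.swap)
    then show ?thesis
      by (simp add: y_def sum.distrib column_sum X_def sum_distrib_left[symmetric] algebra_simps)
  qed
  have yy: "(\<Sum>i\<in>{0..<n}. (y i)\<^sup>2) = (r + \<mu>) * (Q + \<mu> * N) + c * X\<^sup>2"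
  proof -
    have "(\<Sum>i\<in>{0..<n}. (y i)\<^sup>2) = (\<Sum>i\<in>{0..<n}. (z i)\<^sup>2 + 2 * \<mu> * (x i * z i) + \<mu>\<^sup>2 * (x i)\<^sup>2)"
      by (simp add: y_def power2_eq_square algebra_simps)
    also have "\<dots> = (\<Sum>i\<in>{0..<n}. (z i)\<^sup>2) + 2 * \<mu> * Q + \<mu>\<^sup>2 * N"
      by (simp add: sum.distrib sum_distrib_left[symmetric] xz N_def)
    finally show ?thesis
      unfolding zz by (simp add: power2_eq_square algebra_simps)
  qed
  \<comment> \<open>Cauchy-Schwarz against the constant vector, as a sum of squared deviations from the mean\<close>
  have "0 \<le> (\<Sum>i\<in>{0..<n}. (n * y i - (k + \<mu>) * X)\<^sup>2)"
    by (intro sum_nonneg) simp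
  also have "\<dots> = (\<Sum>i\<in>{0..<n}. n\<^sup>2 * (y i)\<^sup>2 - 2 * n * ((k + \<mu>) * X) * y i + ((k + \<mu>) * X)\<^sup>2)"
    by (simp add: power2_eq_square algebra_simps)
  also have "\<dots> = n\<^sup>2 * (\<Sum>i\<in>{0..<n}. (y i)\<^sup>2) - n * ((k + \<mu>) * X)\<^sup>2"
    by (simp add: sum.distrib sum_subtractf sum_distrib_left[symmetric] Y power2_eq_square)
  also have "\<dots> = n * (n * (\<Sum>i\<in>{0..<n}. (y i)\<^sup>2) - ((k + \<mu>) * X)\<^sup>2)"
    by (simp add: power2_eq_square algebra_simps)
  also have "n * (\<Sum>i\<in>{0..<n}. (y i)\<^sup>2) - ((k + \<mu>) * X)\<^sup>2
      = (r + \<mu>) * (n * (Q + \<mu> * N)) - (k + \<mu>) * (r + \<mu>) * X\<^sup>2"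
  proof -
    have "c * n * X\<^sup>2 - ((k + \<mu>) * X)\<^sup>2 = - ((k + \<mu>) * (r + \<mu>) * X\<^sup>2)"
      unfolding order_identity[symmetric] by (simp add: power2_eq_square algebra_simps)
    then show ?thesis
      unfolding yy by (simp add: algebra_simps)
  qed
  finally have "(k + \<mu>) * (r + \<mu>) * X\<^sup>2 \<le> (r + \<mu>) * (n * (Q + \<mu> * N))"
    using pos by (simp add: zero_le_mult_iff)
  moreover have "0 \<le> (k + \<mu>) * (r + \<mu>) * X\<^sup>2"
    using pos by simp
  ultimately have "0 \<le> (r + \<mu>) * (n * (Q + \<mu> * N))"
    by linarith
  then have "0 \<le> Q + \<mu> * N"
    using pos by (simp add: zero_le_mult_iff)
  then show ?thesis
    by (simp add: Q_def N_def)
qed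

text \<open>
  The matrix $(A - r I)(A - k I)$, with the square of $A$ eliminated. Its columns are
  eigenvectors for \<open>- \<mu>\<close> (\<open>adj_proj\<close>), and it is a multiple of an orthogonal projection
  (\<open>proj_proj\<close>). All its diagonal entries are equal, so its scaled columns are unit vectors
  that attain \<open>quadratic_form_ge\<close> with equality in every coordinate.
\<close>

definition proj :: "nat \<Rightarrow> nat \<Rightarrow> real" where
  "proj i j = (\<mu> + k) * (r * of_bool (i = j) - a i j) + c"

lemma adj_proj:
  assumes "i < n" "j < n"
  shows "(\<Sum>h\<in>{0..<n}. a i h * proj h j) = - \<mu> * proj i j"
proof -
  have "(\<Sum>h\<in>{0..<n}. a i h * proj h j)
      = (\<Sum>h\<in>{0..<n}. (\<mu> + k) * r * (a i h * of_bool (h = j)) - (\<mu> + k) * (a i h * a h j) + c * a i h)"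
    by (simp add: proj_def algebra_simps)
  also have "\<dots> = (\<mu> + k) * r * a i j
      - (\<mu> + k) * (\<mu> * r * of_bool (i = j) + (r - \<mu>) * a i j + c) + c * k"
    using assms by (simp add: sum.distrib sum_subtractf sum_distrib_left[symmetric] row sq sum_of_bool_mult)
  finally show ?thesis
    by (simp add: proj_def algebra_simps)
qed

lemma proj_sym: "i < n \<Longrightarrow> j < n \<Longrightarrow> proj i j = proj j i"
  by (auto simp: proj_def sym)

lemma proj_column:
  assumes "j < n"
  shows "(\<Sum>h\<in>{0..<n}. proj h j) = 0"
proof -
  have "(\<Sum>h\<in>{0..<n}. proj h j) = (\<Sum>h\<in>{0..<n}. (\<mu> + k) * r * of_bool (h = j) - (\<mu> + k) * a h j + c)"
    by (simp add: proj_def algebra_simps)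
  also have "\<dots> = (\<mu> + k) * r - (\<mu> + k) * k + n * c"
    unfolding sum.distrib sum_subtractf sum_of_bool_mult(2)[OF assms]
    by (simp add: sum_distrib_left[symmetric] column_sum[OF assms])
  also have "\<dots> = 0"
    using order_identity by (simp add: algebra_simps)
  finally show ?thesis .
qed

lemma proj_proj:
  assumes "i < n" "j < n"
  shows "(\<Sum>h\<in>{0..<n}. proj i h * proj h j) = (\<mu> + k) * (r + \<mu>) * proj i j"
proof -
  have "(\<Sum>h\<in>{0..<n}. proj i h * proj h j)
      = (\<Sum>h\<in>{0..<n}. (\<mu> + k) * r * (of_bool (i = h) * proj h j) - (\<mu> + k) * (a i h * proj h j) + c * proj h j)"
    by (rule sum.cong) (auto simp: proj_def algebra_simps)
  also have "\<dots> = (\<mu> + k) * r * proj i j - (\<mu> + k) * (- \<mu> * proj i j) + c * 0"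
    unfolding sum.distrib sum_subtractf sum_distrib_left[symmetric]
    by (simp only: adj_proj[OF assms] proj_column[OF assms(2)] sum_of_bool_mult(1)[OF assms(1)])
  finally show ?thesis
    by (simp add: algebra_simps)
qed

definition proj_diag :: real where "proj_diag = (\<mu> + k) * r + c"

lemma proj_diag_pos: "proj_diag > 0"
  using pos by (simp add: proj_diag_def add_nonneg_pos)

definition embed :: "nat \<Rightarrow> real vec" where
  "embed i = vec n (\<lambda>h. proj h i / sqrt ((\<mu> + k) * (r + \<mu>) * proj_diag))"

text \<open>
  The scaling turns the square of \<open>proj\<close> back into \<open>proj\<close>, so the Gram matrix is again a
  combination of the identity, the adjacency matrix and the all-ones matrix.
\<close>

lemma embed_inner:
  assumes "i < n" "j < n"
  shows "embed i \<bullet> embed j = proj i j / proj_diag"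
proof -
  have p: "(\<mu> + k) * (r + \<mu>) > 0"
    using pos by simp
  have "embed i \<bullet> embed j = (\<Sum>h\<in>{0..<n}. proj i h * proj h j) / ((\<mu> + k) * (r + \<mu>) * proj_diag)"
    using assms p proj_diag_pos
    by (auto simp: scalar_prod_def embed_def sum_divide_distrib proj_sym intro!: sum.cong)
  also have "\<dots> = proj i j / proj_diag"
    unfolding proj_proj[OF assms] using p by (metis less_irrefl mult_divide_mult_cancel_left)
  finally show ?thesis .
qed

lemma embed_unit: "i < n \<Longrightarrow> embed i \<bullet> embed i = 1"
  using proj_diag_pos by (simp add: embed_inner proj_def diag proj_diag_def)

lemma embed_quadratic: "(\<Sum>i\<in>{0..<n}. \<Sum>j\<in>{0..<n}. a i j * (embed i \<bullet> embed j)) = - \<mu> * n"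
proof -
  have "(\<Sum>i\<in>{0..<n}. \<Sum>j\<in>{0..<n}. a i j * (embed i \<bullet> embed j)) = (\<Sum>i\<in>{0..<n}. (\<Sum>j\<in>{0..<n}. a i j * proj j i) / proj_diag)"
    by (auto simp: embed_inner proj_sym sum_divide_distrib intro!: sum.cong)
  also have "\<dots> = (\<Sum>i\<in>{0..<n}. - \<mu>)"
    using proj_diag_pos by (intro sum.cong refl) (simp add: adj_proj, simp add: proj_def diag proj_diag_def)
  finally show ?thesis
    by simp
qed

end

section \<open>Adjacency matrices and eigenvalues of numbered graphs\<close>

definition adj :: "nat pair_pre_digraph \<Rightarrow> nat \<Rightarrow> nat \<Rightarrow> real" where
  "adj G i j = of_bool ((i, j) \<in> parcs G)"

context
  fixes G
  assumes G: "numbered_graph G"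
begin

lemma pverts_eq: "pverts G = {0..<order G}"
  using G by (simp add: numbered_graph_def)

lemma arcD:
  assumes "(u, v) \<in> parcs G"
  shows "(v, u) \<in> parcs G" "u \<noteq> v" "u < order G" "v < order G"
proof -
  interpret pair_graph G
    using G by (simp add: numbered_graph_def)
  show "(v, u) \<in> parcs G" "u \<noteq> v"
    using assms arcs_symmetric pair_no_loops by fastforce+
  show "u < order G" "v < order G"
    using in_arcsD1[OF assms] in_arcsD2[OF assms] pverts_eq by auto
qed

lemma adj_sym: "adj G i j = adj G j i"
  by (auto simp: adj_def dest: arcD)

lemma adj_diag: "adj G i i = 0"
  by (auto simp: adj_def dest: arcD)

lemma sum_adj_row: "(\<Sum>j\<in>{0..<order G}. adj G i j) = card (neighbours G i)"
proof -
  have "neighbours G i = {0..<order G} \<inter> {j. (i, j) \<in> parcs G}"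
    unfolding neighbours_def by (subst (1) pverts_eq) auto
  then show ?thesis
    by (simp add: adj_def)
qed

lemma sum_adj_adj:
  "(\<Sum>h\<in>{0..<order G}. adj G i h * adj G h j) = card (neighbours G i \<inter> neighbours G j)"
proof -
  have "neighbours G i \<inter> neighbours G j = {0..<order G} \<inter> {h. (i, h) \<in> parcs G \<and> (h, j) \<in> parcs G}"
    unfolding neighbours_def by (subst (1 2) pverts_eq) (auto dest: arcD)
  then show ?thesis
    by (simp add: adj_def of_bool_conj[symmetric])
qed

lemma finite_neighbours: "finite (neighbours G v)"
  unfolding neighbours_def by (subst pverts_eq) simp

lemma neighbours_iff: "u \<in> neighbours G v \<longleftrightarrow> (v, u) \<in> parcs G"
  unfolding neighbours_def by (subst pverts_eq) (auto dest: arcD)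

end

lemma eigenvalue_adj_mat_iff:
  "eigenvalue (adj_mat G) e \<longleftrightarrow> (\<exists>x. (\<exists>i<order G. x i \<noteq> 0) \<and>
     (\<forall>i<order G. (\<Sum>j\<in>{0..<order G}. adj G i j * x j) = e * x i))" (is "?L \<longleftrightarrow> ?R")
proof
  assume ?L
  then obtain v where v: "v \<in> carrier_vec (order G)" "v \<noteq> 0\<^sub>v (order G)" "adj_mat G *\<^sub>v v = e \<cdot>\<^sub>v v"
    by (auto simp: eigenvalue_def eigenvector_def adj_mat_def)
  have "\<exists>i<order G. v $ i \<noteq> 0"
    using v(1,2) by (metis carrier_vecD eq_vecI index_zero_vec)
  moreover have "(\<Sum>j\<in>{0..<order G}. adj G i j * v $ j) = e * v $ i" if "i < order G" for i
  proof -
    have "(adj_mat G *\<^sub>v v) $ i = (e \<cdot>\<^sub>v v) $ i"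
      by (simp add: v)
    then show ?thesis
      using that v(1) by (simp add: adj_mat_def adj_def scalar_prod_def of_bool_def)
  qed
  ultimately show ?R
    by blast
next
  assume ?R
  then obtain x i where x: "i < order G" "x i \<noteq> 0"
    "\<And>i. i < order G \<Longrightarrow> (\<Sum>j\<in>{0..<order G}. adj G i j * x j) = e * x i"
    by blast
  have "vec (order G) x \<noteq> 0\<^sub>v (order G)"
    using x(1,2) by (metis index_vec index_zero_vec(1))
  moreover have "adj_mat G *\<^sub>v vec (order G) x = e \<cdot>\<^sub>v vec (order G) x"
    using x(3) by (intro eq_vecI) (simp_all add: adj_mat_def adj_def scalar_prod_def of_bool_def)
  ultimately show ?L
    unfolding eigenvalue_def eigenvector_def by (intro exI[of _ "vec (order G) x"]) (simp add: adj_mat_def)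
qed

text \<open>
  An eigenvector $x$ for \<open>- \<mu>\<close> has coordinate sum 0, because \<open>- \<mu>\<close> differs from the degree.
  Applying the equation for $A^2$ to $x$ then gives the quadratic equation that relates \<open>\<mu>\<close> to the
  parameters of the graph, and the second root \<open>r\<close> is defined from the sum of the roots. If no
  two distinct nonadjacent vertices had a common neighbour, the graph would be a disjoint union of complete
  graphs and the quadratic equation would force $\mu = 1$; this excludes disconnected and complete
  graphs.
\<close>

lemma strongly_regular_parameters:
  assumes G: "numbered_graph G" and sr: "strongly_regular G"
    and ev: "eigenvalue (adj_mat G) (- \<mu>)" and \<mu>: "\<mu> > 1"
  shows "\<exists>k c r. srg_matrix (order G) (adj G) k c r \<mu>"
proof -
  let ?n = "order G"
  note V = pverts_eq[OF G]
  obtain k where k: "\<And>v. v < ?n \<Longrightarrow> card (neighbours G v) = k"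
    using sr V unfolding strongly_regular_def regular_def by (metis atLeastLessThan_iff zero_le)
  obtain l where l: "\<And>u v. (u, v) \<in> parcs G \<Longrightarrow> card (neighbours G u \<inter> neighbours G v) = l"
    using sr arcD(3,4)[OF G] V unfolding strongly_regular_def by (metis atLeastLessThan_iff zero_le)
  \<comment> \<open>for a complete graph every value of c satisfies the first condition; 0 makes the argument for
    \<open>c \<noteq> 0\<close> below cover that case\<close>
  obtain c where c: "\<And>u v. \<lbrakk>u < ?n; v < ?n; u \<noteq> v; (u, v) \<notin> parcs G\<rbrakk> \<Longrightarrow>
        card (neighbours G u \<inter> neighbours G v) = c"
    and c': "c = 0 \<or> (\<exists>u v. u < ?n \<and> v < ?n \<and> u \<noteq> v \<and> (u, v) \<notin> parcs G)"
  proof (cases "\<exists>u v. u < ?n \<and> v < ?n \<and> u \<noteq> v \<and> (u, v) \<notin> parcs G")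
    case True
    obtain c where "\<And>u v. \<lbrakk>u < ?n; v < ?n; u \<noteq> v; (u, v) \<notin> parcs G\<rbrakk> \<Longrightarrow>
        card (neighbours G u \<inter> neighbours G v) = c"
      using sr V unfolding strongly_regular_def by (metis atLeastLessThan_iff zero_le)
    with True that show ?thesis
      by blast
  next
    case False
    with that[of 0] show ?thesis
      by blast
  qed
  have ck: "c \<le> k"
    using c'
  proof
    assume "\<exists>u v. u < ?n \<and> v < ?n \<and> u \<noteq> v \<and> (u, v) \<notin> parcs G"
    then obtain u v where uv: "u < ?n" "v < ?n" "u \<noteq> v" "(u, v) \<notin> parcs G"
      by blast
    show ?thesis
      using card_mono[OF finite_neighbours[OF G], of "neighbours G u \<inter> neighbours G v" u]
      by (simp add: c[OF uv] k[OF uv(1)])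
  qed simp
  have row: "(\<Sum>j\<in>{0..<?n}. adj G i j) = k" if "i < ?n" for i
    by (simp add: sum_adj_row[OF G] k that)
  have sq: "(\<Sum>h\<in>{0..<?n}. adj G i h * adj G h j)
      = (real k - c) * of_bool (i = j) + (real l - c) * adj G i j + c" if "i < ?n" "j < ?n" for i j
    unfolding sum_adj_adj[OF G] using that k l c arcD(2)[OF G] by (auto simp: adj_def)
  obtain x i where x: "i < ?n" "x i \<noteq> 0"
    "\<And>i. i < ?n \<Longrightarrow> (\<Sum>j\<in>{0..<?n}. adj G i j * x j) = - \<mu> * x i"
    using ev unfolding eigenvalue_adj_mat_iff by blast
  have sum_x: "(\<Sum>j\<in>{0..<?n}. x j) = 0"
  proof -
    have "- \<mu> * (\<Sum>i\<in>{0..<?n}. x i) = (\<Sum>i\<in>{0..<?n}. \<Sum>j\<in>{0..<?n}. adj G i j * x j)"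
      by (simp add: sum_distrib_left x(3))
    also have "\<dots> = (\<Sum>j\<in>{0..<?n}. (\<Sum>i\<in>{0..<?n}. adj G j i) * x j)"
      unfolding sum_distrib_right by (subst sum.swap) (simp add: adj_sym[OF G])
    also have "\<dots> = k * (\<Sum>j\<in>{0..<?n}. x j)"
      by (simp add: row sum_distrib_left)
    finally have "(k + \<mu>) * (\<Sum>j\<in>{0..<?n}. x j) = 0"
      by (simp add: algebra_simps)
    then show ?thesis
      using \<mu> by simp
  qed
  have quadratic: "\<mu> * \<mu> = (real k - c) - (real l - c) * \<mu>"
  proof -
    have "\<mu> * \<mu> * x i = - \<mu> * (\<Sum>h\<in>{0..<?n}. adj G i h * x h)"
      by (simp add: x(3)[OF x(1)])
    also have "\<dots> = (\<Sum>h\<in>{0..<?n}. adj G i h * (\<Sum>j\<in>{0..<?n}. adj G h j * x j))"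
      unfolding sum_distrib_left[of "- \<mu>"] by (simp add: x(3) mult.left_commute)
    also have "\<dots> = (\<Sum>j\<in>{0..<?n}. (\<Sum>h\<in>{0..<?n}. adj G i h * adj G h j) * x j)"
      unfolding sum_distrib_left sum_distrib_right by (subst sum.swap) (simp add: ac_simps)
    also have "\<dots> = (\<Sum>j\<in>{0..<?n}. (real k - c) * (of_bool (i = j) * x j)
        + (real l - c) * (adj G i j * x j) + c * x j)"
    proof (rule sum.cong[OF refl])
      fix j assume "j \<in> {0..<?n}"
      then have "j < ?n"
        by simp
      then show "(\<Sum>h\<in>{0..<?n}. adj G i h * adj G h j) * x j = (real k - c) * (of_bool (i = j) * x j)
          + (real l - c) * (adj G i j * x j) + c * x j"
        unfolding sq[OF x(1) \<open>j < ?n\<close>] by (simp add: algebra_simps)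
    qed
    also have "\<dots> = (real k - c) * x i + (real l - c) * (- \<mu> * x i) + real c * 0"
      unfolding sum.distrib sum_distrib_left[symmetric] sum_x x(3)[OF x(1)]
        sum_of_bool_mult(1)[OF x(1)] ..
    finally have "(\<mu> * \<mu> - ((real k - c) - (real l - c) * \<mu>)) * x i = 0"
      by (simp add: algebra_simps)
    then show ?thesis
      using x(2) by simp
  qed
  have "c \<noteq> 0"
  proof
    assume [simp]: "c = 0"
    obtain v where v: "(i, v) \<in> parcs G"
    proof (rule ccontr)
      assume "\<not> thesis"
      with that have "(\<Sum>j\<in>{0..<?n}. adj G i j * x j) = 0"
        by (intro sum.neutral) (auto simp: adj_def)
      with x \<mu> show False
        by simp
    qed
    \<comment> \<open>adjacency is transitive: a neighbour w of i that is not adjacent to v would share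
      the neighbour i with v\<close>
    have "neighbours G i \<inter> neighbours G v = neighbours G i - {v}"
    proof (intro equalityI subsetI)
      fix w assume "w \<in> neighbours G i \<inter> neighbours G v"
      then show "w \<in> neighbours G i - {v}"
        using arcD(2)[OF G] by (auto simp: neighbours_iff[OF G])
    next
      fix w assume w: "w \<in> neighbours G i - {v}"
      have "w \<in> neighbours G v"
      proof (rule ccontr)
        assume "w \<notin> neighbours G v"
        with w v have "card (neighbours G v \<inter> neighbours G w) = 0"
          using c[of v w] arcD(4)[OF G] by (auto simp: neighbours_iff[OF G])
        moreover have "i \<in> neighbours G v \<inter> neighbours G w"
          using v w arcD(1)[OF G] by (auto simp: neighbours_iff[OF G])
        ultimately show False
          using finite_neighbours[OF G] by auto
      qed
      with w show "w \<in> neighbours G i \<inter> neighbours G v"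
        by simp
    qed
    then have "l = k - 1"
      using l[OF v] k[OF x(1)] v by (simp add: neighbours_iff[OF G])
    moreover have "k \<ge> 1"
      using v k[OF x(1)] finite_neighbours[OF G, of i]
      by (metis One_nat_def Suc_leI card_gt_0_iff empty_iff neighbours_iff[OF G])
    ultimately have "(\<mu> - 1) * (\<mu> + k) = 0"
      using quadratic by (simp add: of_nat_diff algebra_simps)
    then show False
      using \<mu> by simp
  qed
  \<comment> \<open>the roots r and - \<mu> of the quadratic equation sum to the difference of l and c\<close>
  define r where "r = real l - c + \<mu>"
  have r: "\<mu> * r = real k - c"
    using quadratic by (simp add: r_def algebra_simps)
  have "srg_matrix ?n (adj G) k c r \<mu>"
  proof
    have "0 \<le> \<mu> * r"
      using r ck by simp
    then show "r \<ge> 0"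
      using \<mu> by (simp add: zero_le_mult_iff)
    show "(\<Sum>h\<in>{0..<?n}. adj G i h * adj G h j) = \<mu> * r * of_bool (i = j) + (r - \<mu>) * adj G i j + c"
      if "i < ?n" "j < ?n" for i j
      unfolding sq[OF that] r by (simp add: r_def)
  qed (use \<open>c \<noteq> 0\<close> \<mu> x(1) in \<open>auto simp: adj_sym[OF G] adj_diag[OF G] row\<close>)
  then show ?thesis
    by blast
qed

section \<open>The performance ratio of a doubly transitive strongly regular graph\<close>

text \<open>
  Double transitivity makes \<open>w\<close> constant on the edges at each vertex. Two edges at different vertices
  are compared through the edge that joins the vertices or through the two edges to a common
  neighbour.
\<close>

lemma edge_values_equal:
  fixes w :: "nat \<Rightarrow> nat \<Rightarrow> real"
  assumes G: "numbered_graph G" and dt: "doubly_transitive G"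
    and conn: "\<And>u v. \<lbrakk>u < order G; v < order G; u \<noteq> v; (u, v) \<notin> parcs G\<rbrakk> \<Longrightarrow> neighbours G u \<inter> neighbours G v \<noteq> {}"
    and sym: "\<And>i j. (i, j) \<in> parcs G \<Longrightarrow> w i j = w j i"
    and inv: "\<And>\<phi> i j. \<phi> \<in> Aut G \<Longrightarrow> i < order G \<Longrightarrow> j < order G \<Longrightarrow> w (\<phi> i) (\<phi> j) = w i j"
    and uv: "(u, v) \<in> parcs G" and xy: "(x, y) \<in> parcs G"
  shows "w u v = w x y"
proof -
  have star: "w v i = w v j" if "(v, i) \<in> parcs G" "(v, j) \<in> parcs G" for v i j
  proof -
    have "v \<in> pverts G" "i \<in> neighbours G v" "j \<in> neighbours G v"
      using that arcD(3)[OF G] pverts_eq[OF G] by (auto simp: neighbours_iff[OF G])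
    then obtain \<phi> where "\<phi> \<in> Aut G" "\<phi> v = v" "\<phi> i = j"
      using dt unfolding doubly_transitive_def by blast
    then show ?thesis
      using inv[of \<phi> v i] arcD(3,4)[OF G that(1)] by simp
  qed
  show ?thesis
  proof (cases "u = x")
    case True
    with star uv xy show ?thesis by blast
  next
    case False
    show ?thesis
    proof (cases "(u, x) \<in> parcs G")
      case True
      then show ?thesis
        using star[OF uv True] star[OF xy arcD(1)[OF G True]] sym[OF True] by simp
    next
      case ux: False
      obtain h where h: "(u, h) \<in> parcs G" "(x, h) \<in> parcs G"
        using conn[of u x] ux False arcD(3)[OF G] uv xy by (auto simp: neighbours_iff[OF G])
      have "w u v = w h u"
        using star[OF uv h(1)] sym[OF h(1)] by simp
      also have "\<dots> = w h x"
        using star arcD(1)[OF G] h by blast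
      also have "\<dots> = w x y"
        using star[OF xy h(2)] sym[OF h(2)] by simp
      finally show ?thesis .
    qed
  qed
qed

lemma unit_embedding_inner:
  assumes "numbered_graph G" "unit_embedding G f"
  obtains p where "\<And>i. i < order G \<Longrightarrow> f i \<in> carrier_vec p" "\<And>i. i < order G \<Longrightarrow> f i \<bullet> f i = 1"
  using assms(2) pverts_eq[OF assms(1)] unfolding unit_embedding_def
  by (metis atLeastLessThan_iff zero_le)

lemma sum_edges:
  fixes w :: "real \<Rightarrow> real"
  assumes G: "numbered_graph G" and f: "unit_embedding G f"
  shows "(\<Sum>(i, j)\<in>{(i, j). i < j \<and> j < order G}. adj_mat G $$ (i, j) * w (f i \<bullet> f j))
    = (\<Sum>i\<in>{0..<order G}. \<Sum>j\<in>{0..<order G}. adj G i j * w (f i \<bullet> f j)) / 2"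
proof -
  obtain p where p: "\<And>i. i < order G \<Longrightarrow> f i \<in> carrier_vec p"
    using unit_embedding_inner[OF G f] by metis
  have "(\<Sum>(i, j)\<in>{(i, j). i < j \<and> j < order G}. adj_mat G $$ (i, j) * w (f i \<bullet> f j))
      = (\<Sum>(i, j)\<in>{(i, j). i < j \<and> j < order G}. adj G i j * w (f i \<bullet> f j))"
    by (intro sum.cong refl) (auto simp: adj_mat_def adj_def)
  also have "\<dots> = (\<Sum>i\<in>{0..<order G}. \<Sum>j\<in>{0..<order G}. adj G i j * w (f i \<bullet> f j)) / 2"
  proof (rule sum_upper_triangle)
    show "adj G i j * w (f i \<bullet> f j) = adj G j i * w (f j \<bullet> f i)" if "i < order G" "j < order G" for i j
      using adj_sym[OF G, of i j] comm_scalar_prod[OF p[OF that(1)] p[OF that(2)]] by simp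
  qed (simp add: adj_diag[OF G])
  finally show ?thesis .
qed

text \<open>
  Among unit embeddings, the sum of $f(i) \cdot f(j)$ over all arcs is at least $- \mu n$: apply
  \<open>quadratic_form_ge\<close> to each coordinate of $f$. The embedding by the columns of the projection
  attains this value, which gives \<open>SD\<close>. It also has an invariant Gram matrix, so the choice in
  \<open>performance_ratio\<close> is not vacuous. Whatever invariant optimal embedding is chosen, its inner
  product is constant on edges, and the constant must be $- \mu n / (n k) = - \mu / k$.
\<close>

lemma performance_ratio_formula:
  assumes G: "numbered_graph G" and dt: "doubly_transitive G"
    and srg: "srg_matrix (order G) (adj G) k c r \<mu>"
  shows "performance_ratio G = 2 * k * arccos (- \<mu> / k) / (pi * (k + \<mu>))"
proof -
  interpret srg_matrix "order G" "adj G" k c r \<mu>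
    by (fact srg)
  let ?n = "order G"
  let ?S = "\<lambda>f. \<Sum>i\<in>{0..<?n}. \<Sum>j\<in>{0..<?n}. adj G i j * (f i \<bullet> f j)"
  have edges: "(\<Sum>i\<in>{0..<?n}. \<Sum>j\<in>{0..<?n}. adj G i j) = ?n * k"
    by (simp add: row)
  have k_pos: "k > 0"
    using k_gt pos by linarith
  have SD_val: "SD_val G f = (?n * k - ?S f) / 4" if f: "unit_embedding G f" for f
  proof -
    have "SD_val G f = (\<Sum>i\<in>{0..<?n}. \<Sum>j\<in>{0..<?n}. adj G i j * ((1 - f i \<bullet> f j) / 2)) / 2"
      unfolding SD_val_def by (rule sum_edges[OF G f])
    also have "\<dots> = (\<Sum>i\<in>{0..<?n}. \<Sum>j\<in>{0..<?n}. adj G i j / 2 - adj G i j * (f i \<bullet> f j) / 2) / 2"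
      by (simp add: right_diff_distrib diff_divide_distrib)
    also have "\<dots> = (?n * k - ?S f) / 4"
      by (simp add: sum_subtractf sum_divide_distrib[symmetric] edges)
    finally show ?thesis .
  qed
  have S_ge: "?S f \<ge> - \<mu> * ?n" if f: "unit_embedding G f" for f
  proof -
    obtain p where p: "\<And>i. i < ?n \<Longrightarrow> f i \<in> carrier_vec p" "\<And>i. i < ?n \<Longrightarrow> f i \<bullet> f i = 1"
      using unit_embedding_inner[OF G f] by metis
    have inner: "f i \<bullet> f j = (\<Sum>t\<in>{0..<p}. f i $ t * f j $ t)" if "i < ?n" "j < ?n" for i j
      using p(1)[OF that(2)] by (simp add: scalar_prod_def)
    have "- \<mu> * ?n = (\<Sum>i\<in>{0..<?n}. - \<mu> * (\<Sum>t\<in>{0..<p}. (f i $ t)\<^sup>2))"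
      using p(2) by (simp add: inner power2_eq_square)
    also have "\<dots> = (\<Sum>t\<in>{0..<p}. - \<mu> * (\<Sum>i\<in>{0..<?n}. (f i $ t)\<^sup>2))"
      unfolding sum_distrib_left by (rule sum.swap)
    also have "\<dots> \<le> (\<Sum>t\<in>{0..<p}. \<Sum>i\<in>{0..<?n}. \<Sum>j\<in>{0..<?n}. adj G i j * (f i $ t * f j $ t))"
      by (intro sum_mono quadratic_form_ge)
    also have "\<dots> = (\<Sum>i\<in>{0..<?n}. \<Sum>j\<in>{0..<?n}. \<Sum>t\<in>{0..<p}. adj G i j * (f i $ t * f j $ t))"
      by (subst sum.swap, rule sum.cong[OF refl], rule sum.swap)
    also have "\<dots> = ?S f"
      by (simp add: inner sum_distrib_left)
    finally show ?thesis .
  qed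
  have embed_unit: "unit_embedding G embed"
  proof -
    have "embed i \<in> carrier_vec (?n - 1 + 1) \<and> embed i \<bullet> embed i = 1" if "i \<in> pverts G" for i
    proof -
      have "i < ?n"
        using that pverts_eq[OF G] by auto
      then show ?thesis
        using pos(1) embed_unit[of i] by (simp add: embed_def)
    qed
    then show ?thesis
      unfolding unit_embedding_def by blast
  qed
  have SD: "SD G = ?n * (k + \<mu>) / 4"
    unfolding SD_def
  proof (rule Greatest_equality)
    show "\<exists>f. unit_embedding G f \<and> ?n * (k + \<mu>) / 4 = SD_val G f"
      using embed_unit by (intro exI[of _ embed]) (simp add: SD_val embed_quadratic algebra_simps)
    show "s \<le> ?n * (k + \<mu>) / 4" if "\<exists>f. unit_embedding G f \<and> s = SD_val G f" for s
      using that S_ge by (fastforce simp: SD_val algebra_simps)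
  qed
  define f where "f = (SOME f. optimal_embedding G f \<and> invariant_gram G f)"
  have "invariant_gram G embed"
    unfolding invariant_gram_def
  proof (intro ballI)
    fix \<phi> i j assume \<phi>: "\<phi> \<in> Aut G" and ij: "i \<in> pverts G" "j \<in> pverts G"
    have perm: "\<phi> permutes pverts G" and arc: "(\<phi> i, \<phi> j) \<in> parcs G \<longleftrightarrow> (i, j) \<in> parcs G"
      using \<phi> ij by (auto simp: Aut_def)
    have "\<phi> i < ?n" "\<phi> j < ?n" "i < ?n" "j < ?n"
      using ij permutes_in_image[OF perm] pverts_eq[OF G] by auto
    moreover have "\<phi> i = \<phi> j \<longleftrightarrow> i = j"
      using permutes_inj[OF perm] by (simp add: inj_eq)
    ultimately show "embed (\<phi> i) \<bullet> embed (\<phi> j) = embed i \<bullet> embed j"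
      by (simp add: embed_inner proj_def adj_def arc)
  qed
  moreover have "optimal_embedding G embed"
    unfolding optimal_embedding_def SD using embed_unit
    by (simp add: SD_val embed_quadratic algebra_simps)
  ultimately have "optimal_embedding G f \<and> invariant_gram G f"
    unfolding f_def by (intro someI[where P = "\<lambda>f. optimal_embedding G f \<and> invariant_gram G f"]) simp
  then have f: "unit_embedding G f" "SD_val G f = SD G" "invariant_gram G f"
    by (auto simp: optimal_embedding_def)
  obtain p where p: "\<And>i. i < ?n \<Longrightarrow> f i \<in> carrier_vec p"
    using unit_embedding_inner[OF G f(1)] by metis
  have S: "?S f = - \<mu> * ?n"
    using f(2) unfolding SD SD_val[OF f(1)] by (simp add: algebra_simps)
  have const: "f u \<bullet> f v = f x \<bullet> f y" if "(u, v) \<in> parcs G" "(x, y) \<in> parcs G" for u v x y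
    using G dt _ _ _ that
  proof (rule edge_values_equal)
    show "neighbours G u \<inter> neighbours G v \<noteq> {}"
      if "u < ?n" "v < ?n" "u \<noteq> v" "(u, v) \<notin> parcs G" for u v
    proof
      assume "neighbours G u \<inter> neighbours G v = {}"
      with sum_adj_adj[OF G, of u v] sq[OF that(1,2)] that pos show False
        by (simp add: adj_def)
    qed
    show "f i \<bullet> f j = f j \<bullet> f i" if "(i, j) \<in> parcs G" for i j
      using comm_scalar_prod[OF p p] arcD(3,4)[OF G that] by blast
    show "f (\<phi> i) \<bullet> f (\<phi> j) = f i \<bullet> f j" if "\<phi> \<in> Aut G" "i < ?n" "j < ?n" for \<phi> i j
    proof -
      have "i \<in> pverts G" "j \<in> pverts G"
        using that by (subst pverts_eq[OF G], simp)+
      then show ?thesis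
        using f(3) that(1) by (simp add: invariant_gram_def)
    qed
  qed
  have edge_value: "f i \<bullet> f j = - \<mu> / k" if ij: "(i, j) \<in> parcs G" for i j
  proof -
    have "?S f = (\<Sum>u\<in>{0..<?n}. \<Sum>v\<in>{0..<?n}. adj G u v * (f i \<bullet> f j))"
      using const[OF _ ij] by (intro sum.cong refl) (auto simp: adj_def)
    also have "\<dots> = ?n * k * (f i \<bullet> f j)"
      by (simp add: sum_distrib_right[symmetric] edges)
    finally have "?n * k * (f i \<bullet> f j) = - \<mu> * ?n"
      using S by simp
    then have "real ?n * (k * (f i \<bullet> f j) + \<mu>) = 0"
      by (simp add: algebra_simps)
    then have "k * (f i \<bullet> f j) + \<mu> = 0"
      using pos(1) by simp
    then show ?thesis
      using k_pos by (simp add: field_simps)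
  qed
  have "expected_cut G f
      = 1 / pi * ((\<Sum>i\<in>{0..<?n}. \<Sum>j\<in>{0..<?n}. adj G i j * arccos (f i \<bullet> f j)) / 2)"
    unfolding expected_cut_def by (simp only: sum_edges[OF G f(1)])
  also have "(\<Sum>i\<in>{0..<?n}. \<Sum>j\<in>{0..<?n}. adj G i j * arccos (f i \<bullet> f j))
      = (\<Sum>i\<in>{0..<?n}. \<Sum>j\<in>{0..<?n}. adj G i j * arccos (- \<mu> / k))"
    by (intro sum.cong refl) (auto simp: adj_def edge_value)
  also have "\<dots> = ?n * k * arccos (- \<mu> / k)"
    by (simp add: sum_distrib_right[symmetric] edges)
  finally have cut: "expected_cut G f = ?n * k * arccos (- \<mu> / k) / (2 * pi)"
    by simp
  show ?thesis
  proof -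
    have "performance_ratio G
        = (?n * k * arccos (- \<mu> / k) / (2 * pi)) / (?n * (k + \<mu>) / 4)"
      unfolding performance_ratio_def f_def[symmetric] cut SD ..
    also have "\<dots> = (real ?n * (2 * k * arccos (- \<mu> / k))) / (real ?n * (pi * (k + \<mu>)))"
      by simp
    also have "\<dots> = 2 * k * arccos (- \<mu> / k) / (pi * (k + \<mu>))"
      by (rule mult_divide_mult_cancel_left) (use pos(1) in simp)
    finally show ?thesis .
  qed
qed

section \<open>Asymptotics\<close>

text \<open>
  With $x = \mu / k \to 0$ the ratio is $\frac{2}{\pi} \arccos(-x) / (1 + x)$, and
  $\arccos 0 = \pi / 2$.
\<close>

lemma tendsto_ratio_formula:
  "((\<lambda>k. 2 * k * arccos (- \<mu> / k) / (pi * (k + \<mu>))) \<longlongrightarrow> 1) at_top" for \<mu> :: real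
proof -
  have lim: "((\<lambda>k. \<mu> / k) \<longlongrightarrow> 0) at_top"
    by (rule real_tendsto_divide_at_top[OF tendsto_const filterlim_ident])
  have "((\<lambda>k. arccos (- (\<mu> / k))) \<longlongrightarrow> arccos (- 0)) at_top"
    by (rule isCont_tendsto_compose[OF _ tendsto_minus[OF lim]]) (simp add: isCont_arccos)
  then have "((\<lambda>k. 2 * arccos (- (\<mu> / k)) / (pi * (1 + \<mu> / k))) \<longlongrightarrow> 2 * (pi / 2) / (pi * (1 + 0))) at_top"
    by (intro tendsto_intros lim) simp_all
  moreover have "\<forall>\<^sub>F k in at_top. 2 * arccos (- (\<mu> / k)) / (pi * (1 + \<mu> / k))
      = 2 * k * arccos (- \<mu> / k) / (pi * (k + \<mu>))"
    using eventually_gt_at_top[of "max 0 (- \<mu>)"] by eventually_elim (simp add: field_simps)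
  ultimately show ?thesis
    by (simp add: tendsto_cong)
qed

section \<open>Complete multipartite graphs\<close>

text \<open>
  The \<open>t\<close> parts are residue classes and have size \<open>m\<close>. These graphs show that arbitrarily large
  graphs with smallest eigenvalue \<open>- m\<close> exist, without which the infimum would be taken over the
  empty set.
\<close>

definition complete_multipartite :: "nat \<Rightarrow> nat \<Rightarrow> nat pair_pre_digraph" where
  "complete_multipartite t m = \<lparr>pverts = {0..<t * m},
     parcs = {(i, j). i < t * m \<and> j < t * m \<and> i mod t \<noteq> j mod t}\<rparr>"

context
  fixes t m :: nat
  assumes t: "t \<ge> 2" and m: "m \<ge> 1"
begin

abbreviation (input) "K \<equiv> complete_multipartite t m"

lemma order_K: "order K = t * m"
  by (simp add: complete_multipartite_def)

lemma numbered_K: "numbered_graph K"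
proof -
  have "finite {(i, j). i < t * m \<and> j < t * m \<and> i mod t \<noteq> j mod t}"
    by (rule finite_subset[of _ "{0..<t*m} \<times> {0..<t*m}"]) auto
  then have "pair_graph K"
    by unfold_locales (auto simp: complete_multipartite_def symmetric_def arcs_ends_def arc_to_ends_def sym_def)
  then show ?thesis
    by (simp add: numbered_graph_def complete_multipartite_def)
qed

lemma part_eq: "{i. i < t * m \<and> i mod t = a} = (\<lambda>p. a + t * p) ` {0..<m}" if "a < t"
proof (intro equalityI subsetI)
  fix i assume "i \<in> {i. i < t * m \<and> i mod t = a}"
  then have "i = a + t * (i div t)" "i div t < m"
    by (auto simp: less_mult_imp_div_less mult.commute)
  then show "i \<in> (\<lambda>p. a + t * p) ` {0..<m}"
    by (metis atLeastLessThan_iff imageI zero_le)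
next
  fix i assume "i \<in> (\<lambda>p. a + t * p) ` {0..<m}"
  then obtain p where p: "p < m" "i = a + t * p"
    by auto
  have "t * Suc p \<le> t * m"
    using p(1) by (intro mult_le_mono2) simp
  then show "i \<in> {i. i < t * m \<and> i mod t = a}"
    using p that by simp
qed

lemma card_part: "card {i. i < t * m \<and> i mod t = a} = m" if "a < t"
  unfolding part_eq[OF that] using t by (subst card_image) (auto simp: inj_on_def)

lemma neighbours_K: "neighbours K v = {0..<t * m} - {i. i < t * m \<and> i mod t = v mod t}" if "v < t * m"
  using that by (auto simp: neighbours_def complete_multipartite_def)

lemma strongly_regular_K: "strongly_regular K"
proof -
  have t0: "i mod t < t" for i
    using t by simp
  have deg: "card (neighbours K v) = t * m - m" if "v < t * m" for v
    unfolding neighbours_K[OF that] by (subst card_Diff_subset) (auto simp: card_part t0)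
  have same: "card (neighbours K u \<inter> neighbours K v) = t * m - m"
    if "u < t * m" "v < t * m" "u mod t = v mod t" for u v
    using that deg[of u] neighbours_K[of u] neighbours_K[of v] by simp
  have different: "card (neighbours K u \<inter> neighbours K v) = t * m - 2 * m"
    if uv: "u < t * m" "v < t * m" "u mod t \<noteq> v mod t" for u v
  proof -
    let ?P = "\<lambda>v. {i. i < t * m \<and> i mod t = v mod t}"
    have "neighbours K u \<inter> neighbours K v = {0..<t * m} - (?P u \<union> ?P v)"
      using uv neighbours_K[of u] neighbours_K[of v] by auto
    moreover have "card (?P u \<union> ?P v) = 2 * m"
      using uv by (subst card_Un_disjoint) (auto simp: card_part t0)
    moreover have "card ({0..<t * m} - (?P u \<union> ?P v)) = t * m - card (?P u \<union> ?P v)"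
      by (subst card_Diff_subset) auto
    ultimately show ?thesis
      by simp
  qed
  show ?thesis
    unfolding strongly_regular_def regular_def
    using deg same different by (auto simp: complete_multipartite_def)
qed

text \<open>
  Neighbours \<open>i\<close> and \<open>j\<close> of \<open>v\<close> lie outside the part of \<open>v\<close>. Exchanging their parts, and then two
  vertices inside the part of \<open>j\<close>, moves \<open>i\<close> to \<open>j\<close> and leaves the part of \<open>v\<close> alone.
\<close>

lemma doubly_transitive_K: "doubly_transitive K"
  unfolding doubly_transitive_def
proof (intro ballI)
  fix v i j assume v: "v \<in> pverts K" and "i \<in> neighbours K v" "j \<in> neighbours K v"
  then have i: "i < t * m" "i mod t \<noteq> v mod t" and j: "j < t * m" "j mod t \<noteq> v mod t" and v: "v < t * m"
    by (auto simp: neighbours_def complete_multipartite_def)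
  define a b where "a = i mod t" and "b = j mod t"
  have ab: "a < t" "b < t"
    using t by (simp_all add: a_def b_def)
  \<comment> \<open>exchange the parts of i and j; the quotient by t is the position inside a part\<close>
  define \<sigma> where "\<sigma> x = (if x < t * m then transpose a b (x mod t) + t * (x div t) else x)" for x
  have tr: "transpose a b (x mod t) < t" for x
    using t ab by (auto simp: transpose_def)
  have \<sigma>_mod: "\<sigma> x mod t = transpose a b (x mod t)" and \<sigma>_div: "\<sigma> x div t = x div t"
    and \<sigma>_less: "\<sigma> x < t * m" if "x < t * m" for x
  proof -
    show 1: "\<sigma> x mod t = transpose a b (x mod t)" "\<sigma> x div t = x div t"
      using that tr[of x] t by (simp_all add: \<sigma>_def)
    have "x div t < m"
      using that by (simp add: less_mult_imp_div_less mult.commute)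
    then show "\<sigma> x < t * m"
      using 1(2) t by (metis div_less_iff_less_mult less_le_trans mult.commute pos2)
  qed
  have \<sigma>_\<sigma>: "\<sigma> (\<sigma> x) = x" for x
  proof (cases "x < t * m")
    case True
    then show ?thesis
      using \<sigma>_mod[OF True] \<sigma>_div[OF True] \<sigma>_less[OF True] by (simp add: \<sigma>_def[of "\<sigma> x"])
  qed (simp add: \<sigma>_def)
  have \<sigma>: "\<sigma> permutes {0..<t * m}"
    unfolding permutes_def
  proof (intro conjI allI impI)
    show "\<sigma> x = x" if "x \<notin> {0..<t * m}" for x
      using that by (simp add: \<sigma>_def)
    show "\<exists>!x. \<sigma> x = y" for y
      using \<sigma>_\<sigma> by metis
  qed
  have \<sigma>_parts: "\<sigma> x mod t = \<sigma> y mod t \<longleftrightarrow> x mod t = y mod t" if "x < t * m" "y < t * m" for x y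
    using that by (simp add: \<sigma>_mod inj_eq)
  define \<tau> where "\<tau> = transpose (\<sigma> i) j"
  have same: "\<sigma> i mod t = j mod t"
    using \<sigma>_mod[OF i(1)] by (simp add: a_def b_def)
  have \<tau>: "\<tau> permutes {0..<t * m}"
    unfolding \<tau>_def using \<sigma>_less[OF i(1)] j by (intro permutes_swap_id) auto
  have \<tau>_mod: "\<tau> x mod t = x mod t" for x
    unfolding \<tau>_def using same by (auto simp: transpose_def)
  have "\<tau> \<circ> \<sigma> permutes {0..<t * m}"
    by (rule permutes_compose[OF \<sigma> \<tau>])
  moreover have "(\<tau> \<circ> \<sigma>) x < t * m" if "x < t * m" for x
    using permutes_in_image[OF \<open>\<tau> \<circ> \<sigma> permutes _\<close>, of x] that by simp
  ultimately have "\<tau> \<circ> \<sigma> \<in> Aut K"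
    by (simp add: Aut_def complete_multipartite_def \<tau>_mod \<sigma>_parts)
  moreover have "(\<tau> \<circ> \<sigma>) v = v"
  proof -
    have "\<sigma> v = v"
      using v i(2) j(2) by (simp add: \<sigma>_def a_def b_def)
    moreover have "\<tau> v = v"
      unfolding \<tau>_def using same j(2) by (intro transpose_apply_other) auto
    ultimately show ?thesis
      by simp
  qed
  moreover have "(\<tau> \<circ> \<sigma>) i = j"
    by (simp add: \<tau>_def)
  ultimately show "\<exists>\<phi>\<in>Aut K. \<phi> v = v \<and> \<phi> i = j"
    by blast
qed

lemma sum_adj_K:
  fixes x :: "nat \<Rightarrow> real"
  assumes "i < t * m"
  shows "(\<Sum>j\<in>{0..<t * m}. adj K i j * x j)
    = (\<Sum>j\<in>{0..<t * m}. x j) - (\<Sum>j | j < t * m \<and> j mod t = i mod t. x j)"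
proof -
  have "(\<Sum>j\<in>{0..<t * m}. adj K i j * x j)
      = (\<Sum>j\<in>{0..<t * m}. x j - (if j mod t = i mod t then x j else 0))"
    using assms by (intro sum.cong) (auto simp: adj_def complete_multipartite_def)
  also have "\<dots> = (\<Sum>j\<in>{0..<t * m}. x j) - (\<Sum>j\<in>{j \<in> {0..<t * m}. j mod t = i mod t}. x j)"
    unfolding sum_subtractf by (subst sum.inter_filter) auto
  finally show ?thesis
    by simp
qed

text \<open>
  The difference of the indicators of two parts is an eigenvector for \<open>- m\<close>. If $A x = e x$ with
  $e < 0$, then $x$ is constant on each part, hence $(e + m) x_i = S$ for all $i$, where $S$ is the
  coordinate sum. For $e + m < 0$, summing over $i$ gives $(e + m) S = n S$, so $S = 0$ and $x = 0$.
\<close>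

lemma smallest_eigenvalue_K: "smallest_eigenvalue (adj_mat K) (- real m)"
  unfolding smallest_eigenvalue_def eigenvalue_adj_mat_iff order_K
proof (intro conjI allI impI)
  have t0: "i mod t < t" for i
    using t by simp
  have tm: "0 < t * m" "1 < t * m"
    using mult_le_mono[OF t m] by linarith+
  define x :: "nat \<Rightarrow> real" where "x i = of_bool (i mod t = 0) - of_bool (i mod t = 1)" for i
  have part: "(\<Sum>j | j < t * m \<and> j mod t = a. of_bool (j mod t = b)) = of_bool (a = b) * real m"
    if "a < t" for a b
  proof -
    have "(\<Sum>j | j < t * m \<and> j mod t = a. of_bool (j mod t = b))
        = (\<Sum>j | j < t * m \<and> j mod t = a. of_bool (a = b))"
      by (rule sum.cong) auto
    then show ?thesis
      by (simp add: card_part[OF that])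
  qed
  have total: "(\<Sum>j\<in>{0..<t * m}. of_bool (j mod t = a)) = real m" if "a < t" for a
  proof -
    have "{0..<t * m} \<inter> {j. j mod t = a} = {j. j < t * m \<and> j mod t = a}"
      by auto
    then show ?thesis
      by (simp add: card_part[OF that])
  qed
  have "x 0 \<noteq> 0"
    by (simp add: x_def)
  moreover have "(\<Sum>j\<in>{0..<t * m}. adj K i j * x j) = - real m * x i" if "i < t * m" for i
  proof -
    have "(\<Sum>j\<in>{0..<t * m}. x j) = 0"
      unfolding x_def sum_subtractf using total[of 0] total[of 1] t by linarith
    moreover have "(\<Sum>j | j < t * m \<and> j mod t = i mod t. x j) = real m * x i"
      unfolding x_def sum_subtractf part[OF t0] by (simp add: algebra_simps)
    ultimately show ?thesis
      unfolding sum_adj_K[OF that] by simp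
  qed
  ultimately show "\<exists>x. (\<exists>i<t * m. x i \<noteq> 0) \<and>
      (\<forall>i<t * m. (\<Sum>j\<in>{0..<t * m}. adj K i j * x j) = - real m * x i)"
    using tm by blast
next
  fix e
  assume "\<exists>x. (\<exists>i<t * m. x i \<noteq> 0) \<and> (\<forall>i<t * m. (\<Sum>j\<in>{0..<t * m}. adj K i j * x j) = e * x i)"
  then obtain x i where x: "i < t * m" "x i \<noteq> 0"
    "\<And>i. i < t * m \<Longrightarrow> (\<Sum>j\<in>{0..<t * m}. adj K i j * x j) = e * x i"
    by blast
  define S where "S = (\<Sum>j\<in>{0..<t * m}. x j)"
  show "- real m \<le> e"
  proof (rule ccontr)
    assume "\<not> - real m \<le> e"
    then have e: "e < 0" "e + m < 0"
      by auto
    have const: "(e + m) * x i = S" if i: "i < t * m" for i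
    proof -
      let ?P = "{j. j < t * m \<and> j mod t = i mod t}"
      have row: "e * x u = S - (\<Sum>j | j < t * m \<and> j mod t = u mod t. x j)" if "u < t * m" for u
        using x(3)[OF that] sum_adj_K[OF that, of x] by (simp add: S_def)
      have "e * x j = e * x i" if "j \<in> ?P" for j
        using that i by (simp only: row mem_Collect_eq)
      then have "x j = x i" if "j \<in> ?P" for j
        using that e by simp
      then have "(\<Sum>j\<in>?P. x j) = m * x i"
        using t by (simp add: card_part)
      then show ?thesis
        using x(3)[OF i] sum_adj_K[OF i, of x] by (simp add: S_def algebra_simps)
    qed
    have "(e + m) * S = (\<Sum>j\<in>{0..<t * m}. (e + m) * x j)"
      by (simp add: S_def sum_distrib_left)
    also have "\<dots> = real (t * m) * S"
      by (simp add: const)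
    finally have "S * (real (t * m) - (e + m)) = 0"
      by (simp add: algebra_simps)
    moreover have "real (t * m) - (e + m) > 0"
      using e by (simp add: add_strict_increasing2 less_le_trans[of _ 0])
    ultimately have "S = 0"
      by simp
    with const[OF x(1)] x(2) e show False
      by simp
  qed
qed

lemma complete_multipartite_in_\<R>: "K \<in> \<R> (- real m)"
  by (simp add: \<R>_def numbered_K doubly_transitive_K strongly_regular_K smallest_eigenvalue_K)

end

section \<open>The essential performance ratio\<close>

theorem theorem4p5:
  fixes m :: int
  assumes "m \<ge> 2"
  shows "has_essential_performance_ratio (\<R> (- real_of_int m)) 1"
  unfolding has_essential_performance_ratio_def
proof (rule LIMSEQ_I)
  fix \<epsilon> :: real assume "\<epsilon> > 0"
  define \<mu> where "\<mu> = real_of_int m"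
  have \<mu>: "\<mu> > 1"
    using assms by (simp add: \<mu>_def)
  let ?\<alpha> = "\<lambda>k. 2 * k * arccos (- \<mu> / k) / (pi * (k + \<mu>))"
  have "\<forall>\<^sub>F k in at_top. dist (?\<alpha> k) 1 < \<epsilon> / 2"
    using \<open>\<epsilon> > 0\<close> by (intro tendstoD[OF tendsto_ratio_formula]) simp
  then obtain B where B: "\<And>k. k \<ge> B \<Longrightarrow> dist (?\<alpha> k) 1 < \<epsilon> / 2"
    by (auto simp: eventually_at_top_linorder)
  \<comment> \<open>by \<open>srg_matrix.order_le\<close>, more than \<bar>B\<bar> * (\<bar>B\<bar> + \<mu>) vertices force degree at least B\<close>
  define N where "N = Suc (nat \<lceil>\<bar>B\<bar> * (\<bar>B\<bar> + \<mu>)\<rceil>)"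
  show "\<exists>N. \<forall>n\<ge>N. norm (Inf (performance_ratio ` {G \<in> \<R> (- real_of_int m). order G \<ge> n}) - 1) < \<epsilon>"
  proof (intro exI[of _ N] allI impI)
    fix n assume "n \<ge> N"
    define A where "A = performance_ratio ` {G \<in> \<R> (- \<mu>). order G \<ge> n}"
    have near_one: "\<bar>y - 1\<bar> \<le> \<epsilon> / 2" if "y \<in> A" for y
    proof -
      obtain G where G: "G \<in> \<R> (- \<mu>)" "order G \<ge> n" "y = performance_ratio G"
        using \<open>y \<in> A\<close> by (auto simp: A_def)
      then have ng: "numbered_graph G" and dt: "doubly_transitive G"
        by (auto simp: \<R>_def)
      obtain k c r where srg: "srg_matrix (order G) (adj G) k c r \<mu>"
        using strongly_regular_parameters[OF ng _ _ \<mu>] G(1)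
        by (auto simp: \<R>_def smallest_eigenvalue_def)
      have "B \<le> k"
      proof (rule ccontr)
        assume "\<not> B \<le> k"
        moreover have "k \<ge> 0"
          using srg by (simp add: srg_matrix_def)
        ultimately have "k * (k + \<mu>) \<le> \<bar>B\<bar> * (\<bar>B\<bar> + \<mu>)"
          using \<mu> by (intro mult_mono) auto
        also have "\<dots> < N"
          unfolding N_def by linarith
        also have "\<dots> \<le> order G"
          using G(2) \<open>n \<ge> N\<close> by simp
        finally show False
          using srg_matrix.order_le[OF srg] by simp
      qed
      from B[OF this] show ?thesis
        unfolding G(3) performance_ratio_formula[OF ng dt srg] by (simp add: dist_real_def)
    qed
    have bounds: "1 - \<epsilon> / 2 \<le> y" "y \<le> 1 + \<epsilon> / 2" if "y \<in> A" for y
      using near_one[OF that] by linarith+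
    have "complete_multipartite (n + 2) (nat m) \<in> \<R> (- \<mu>)"
      using complete_multipartite_in_\<R>[of "n + 2" "nat m"] assms by (simp add: \<mu>_def)
    moreover have "n \<le> order (complete_multipartite (n + 2) (nat m))"
    proof -
      have "(n + 2) * 1 \<le> (n + 2) * nat m"
        using assms by (intro mult_le_mono2) simp
      then show ?thesis
        by (simp add: complete_multipartite_def)
    qed
    ultimately obtain y where y: "y \<in> A"
      unfolding A_def by blast
    have "1 - \<epsilon> / 2 \<le> Inf A"
      using y bounds(1) by (intro cInf_greatest) auto
    moreover have "Inf A \<le> 1 + \<epsilon> / 2"
      using bounds y by (intro cInf_lower2[of y] bdd_belowI[of A "1 - \<epsilon> / 2"]) simp_all
    ultimately show "norm (Inf (performance_ratio ` {G \<in> \<R> (- real_of_int m). order G \<ge> n}) - 1) < \<epsilon>"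
      using \<open>\<epsilon> > 0\<close> unfolding A_def \<mu>_def by (simp add: abs_less_iff)
  qed
qed

end
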